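(* Let $d\ge1$ and let $(\mathbf X,Y)$ be a random vector with $\mathbf X\in\mathbb R^d$ and $Y\in\{\pm1\}$ such that $\mathbf X$ is marginally atomless. Let $\{M_k\}_{k\ge0}$ be the log-odds process constructed from the (entropy) cyclic MinimaxSplit algorithm. Then for every integer $k\ge0$, $$\mathbb E[\log(1+e^{-YM_k})]\le\inf_{g\in\mathcal G}\Big(\mathbb E[\log(1+e^{-Yg(\mathbf X)})]+\sqrt{\frac{\log2}{4}}\,2^{-\lfloor k/d\rfloor/2}\|g\|_{\mathrm{TV}}^{1/2}\Big).$$
   Context: $\log$ is the natural logarithm. $\mathbf X=(X_1,\dots,X_d)$ is marginally atomless if $\mathbb P(X_j=x)=0$ for all $j\in\{1,\dots,d\}$, $x\in\mathbb R$. Let $h(p)=-p\log p-(1-p)\log(1-p)$ (with $0\log0=0$), and for $A\subseteq\mathbb R^d$ let $w(A)=\mathbb P(\mathbf X\in A)$ and $\eta_A=\mathbb P(Y=1\mid\mathbf X\in A)$ (with $w(A)h(\eta_A)=0$ if $w(A)=0$). A set $A$ is unsplittable if $w(A)=0$, or if $w(A)>0$ and the conditional law of $Y$ given $\mathbf X\in A$ is a point mass, or if $w(A)>0$ and the conditional law of $\mathbf X$ given $\mathbf X\in A$ is a point mass; otherwise it is splittable. Cyclic MinimaxSplit algorithm (entropy version): nested partitions $\{\pi_k\}_{k\ge0}$ of $\mathbb R^d$ into axis-aligned boxes; $\pi_0=\{\mathbb R^d\}$; given $\pi_k$, put $j=1+(k\bmod d)$; unsplittable $A\in\pi_k$ are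 kept in $\pi_{k+1}$; each splittable $A\in\pi_k$ is replaced by $A_L=\{\mathbf x\in A:x_j<z\}$ and $A_R=A\setminus A_L$, where the threshold $z$ minimizes $\max\{w(A_L)h(\eta_{A_L}),\,w(A_R)h(\eta_{A_R})\}$ (ties broken arbitrarily, minimizer assumed to exist). The process is $M_k=\log\big(\eta_A/(1-\eta_A)\big)$ on $\{\mathbf X\in A\}$, $A\in\pi_k$; if $\eta_A\in\{0,1\}$ then $M_k=\mp\infty$ respectively and $\log(1+e^{-YM_k})=0$ on that cell. $\mathcal G$ is the class of additive functions $g(\mathbf x)=g_1(x_1)+\dots+g_d(x_d)$ on $\mathbb R^d$ with each $g_i:\mathbb R\to\mathbb R$ of bounded variation, and $\|g\|_{\mathrm{TV}}$ is the infimum of $\sum_{i=1}^d\|g_i\|_{\mathrm{TV}}$ over all such additive representations of $g$, where $\|g_i\|_{\mathrm{TV}}$ is the total variation of $g_i$. *)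

theory Defs
  imports "HOL-Probability.Probability"
begin

definition marginally_atomless :: "'w measure \<Rightarrow> ('w \<Rightarrow> real ^ 'n) \<Rightarrow> bool" where
  "marginally_atomless M X \<longleftrightarrow> (\<forall>j x. \<P>(\<omega> in M. X \<omega> $ j = x) = 0)"

text \<open>The value \<open>ln 0 = 0\<close> implements the convention \<open>0 log 0 = 0\<close>.\<close>

definition binary_entropy :: "real \<Rightarrow> real" where
  "binary_entropy p = - p * ln p - (1 - p) * ln (1 - p)"

definition cell_weight :: "'w measure \<Rightarrow> ('w \<Rightarrow> real ^ 'n) \<Rightarrow> (real ^ 'n) set \<Rightarrow> real" where
  "cell_weight M X A = \<P>(\<omega> in M. X \<omega> \<in> A)"

text \<open>On cells of weight zero the conditional probability is \<open>0\<close> (division by zero); such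
  cells contribute nothing to any expectation below.\<close>

definition cell_eta ::
    "'w measure \<Rightarrow> ('w \<Rightarrow> real ^ 'n) \<Rightarrow> ('w \<Rightarrow> real) \<Rightarrow> (real ^ 'n) set \<Rightarrow> real" where
  "cell_eta M X Y A = \<P>(\<omega> in M. Y \<omega> = 1 \<bar> X \<omega> \<in> A)"

definition cell_risk ::
    "'w measure \<Rightarrow> ('w \<Rightarrow> real ^ 'n) \<Rightarrow> ('w \<Rightarrow> real) \<Rightarrow> (real ^ 'n) set \<Rightarrow> real" where
  "cell_risk M X Y A = cell_weight M X A * binary_entropy (cell_eta M X Y A)"

definition cond_law ::
    "'w measure \<Rightarrow> ('w \<Rightarrow> real ^ 'n) \<Rightarrow> (real ^ 'n) set \<Rightarrow> ('w \<Rightarrow> 'b::topological_space) \<Rightarrow> 'b measure"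
  where
  "cond_law M X A Z = distr (uniform_measure M {\<omega> \<in> space M. X \<omega> \<in> A}) borel Z"

definition point_mass :: "'b::topological_space measure \<Rightarrow> bool" where
  "point_mass N \<longleftrightarrow> (\<exists>c. N = return borel c)"

definition unsplittable ::
    "'w measure \<Rightarrow> ('w \<Rightarrow> real ^ 'n) \<Rightarrow> ('w \<Rightarrow> real) \<Rightarrow> (real ^ 'n) set \<Rightarrow> bool" where
  "unsplittable M X Y A \<longleftrightarrow>
     cell_weight M X A = 0 \<or>
     (cell_weight M X A > 0 \<and> point_mass (cond_law M X A Y)) \<or>
     (cell_weight M X A > 0 \<and> point_mass (cond_law M X A X))"

definition left_child :: "'n \<Rightarrow> real \<Rightarrow> (real ^ 'n) set \<Rightarrow> (real ^ 'n) set" where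
  "left_child j z A = {x \<in> A. x $ j < z}"

definition right_child :: "'n \<Rightarrow> real \<Rightarrow> (real ^ 'n) set \<Rightarrow> (real ^ 'n) set" where
  "right_child j z A = A - left_child j z A"

definition split_objective ::
    "'w measure \<Rightarrow> ('w \<Rightarrow> real ^ 'n) \<Rightarrow> ('w \<Rightarrow> real) \<Rightarrow> 'n \<Rightarrow> (real ^ 'n) set \<Rightarrow> real \<Rightarrow> real" where
  "split_objective M X Y j A z =
     max (cell_risk M X Y (left_child j z A)) (cell_risk M X Y (right_child j z A))"

definition minimax_threshold ::
    "'w measure \<Rightarrow> ('w \<Rightarrow> real ^ 'n) \<Rightarrow> ('w \<Rightarrow> real) \<Rightarrow> 'n \<Rightarrow> (real ^ 'n) set \<Rightarrow> real \<Rightarrow> bool" where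
  "minimax_threshold M X Y j A z \<longleftrightarrow>
     (\<forall>z'. split_objective M X Y j A z \<le> split_objective M X Y j A z')"

definition minimax_split_step ::
    "'w measure \<Rightarrow> ('w \<Rightarrow> real ^ 'n) \<Rightarrow> ('w \<Rightarrow> real) \<Rightarrow> 'n \<Rightarrow>
     (real ^ 'n) set set \<Rightarrow> (real ^ 'n) set set \<Rightarrow> bool" where
  "minimax_split_step M X Y j P P' \<longleftrightarrow>
     (\<exists>z :: (real ^ 'n) set \<Rightarrow> real.
        (\<forall>A\<in>P. \<not> unsplittable M X Y A \<longrightarrow> minimax_threshold M X Y j A (z A)) \<and>
        P' = {A \<in> P. unsplittable M X Y A} \<union>
             (\<Union>A\<in>{A \<in> P. \<not> unsplittable M X Y A}. {left_child j (z A) A, right_child j (z A) A}))"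

text \<open>The possible outputs of the algorithm: ties between minimizing thresholds are
  broken arbitrarily. The map \<open>coord\<close> numbers the coordinates by \<open>1, \<dots>, d\<close>, where
  \<open>d = CARD('n)\<close>.\<close>

definition cyclic_minimax_split ::
    "(nat \<Rightarrow> 'n) \<Rightarrow> 'w measure \<Rightarrow> ('w \<Rightarrow> real ^ 'n) \<Rightarrow> ('w \<Rightarrow> real) \<Rightarrow>
     (nat \<Rightarrow> (real ^ 'n) set set) \<Rightarrow> bool" where
  "cyclic_minimax_split coord M X Y \<pi> \<longleftrightarrow>
     \<pi> 0 = {UNIV} \<and>
     (\<forall>k. minimax_split_step M X Y (coord (1 + k mod CARD('n))) (\<pi> k) (\<pi> (Suc k)))"

definition cell_of :: "'a set set \<Rightarrow> 'a \<Rightarrow> 'a set" where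
  "cell_of P x = (THE A. A \<in> P \<and> x \<in> A)"

definition log_odds :: "real \<Rightarrow> ereal" where
  "log_odds p = (if p = 0 then - \<infinity> else if p = 1 then \<infinity> else ereal (ln (p / (1 - p))))"

definition log_odds_process ::
    "'w measure \<Rightarrow> ('w \<Rightarrow> real ^ 'n) \<Rightarrow> ('w \<Rightarrow> real) \<Rightarrow> (nat \<Rightarrow> (real ^ 'n) set set) \<Rightarrow>
     nat \<Rightarrow> 'w \<Rightarrow> ereal" where
  "log_odds_process M X Y \<pi> k \<omega> = log_odds (cell_eta M X Y (cell_of (\<pi> k) (X \<omega>)))"

text \<open>An infinite margin only occurs on cells with \<open>\<eta> \<in> {0, 1}\<close>, where the loss is \<open>0\<close> by
  convention (on a cell of positive weight, \<open>y * m = \<infinity>\<close> holds there almost surely).\<close>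

definition logistic_loss :: "real \<Rightarrow> ereal \<Rightarrow> real" where
  "logistic_loss y m = (if \<bar>m\<bar> = \<infinity> then 0 else ln (1 + exp (- (y * real_of_ereal m))))"

definition variation_sums :: "(real \<Rightarrow> real) \<Rightarrow> real set" where
  "variation_sums f =
     {(\<Sum>i<n. \<bar>f (t (Suc i)) - f (t i)\<bar>) | n t. mono (t :: nat \<Rightarrow> real)}"

definition bounded_variation :: "(real \<Rightarrow> real) \<Rightarrow> bool" where
  "bounded_variation f \<longleftrightarrow> bdd_above (variation_sums f)"

definition total_variation :: "(real \<Rightarrow> real) \<Rightarrow> real" where
  "total_variation f = Sup (variation_sums f)"

definition bv_representation :: "(real ^ 'n \<Rightarrow> real) \<Rightarrow> ('n \<Rightarrow> real \<Rightarrow> real) \<Rightarrow> bool" where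
  "bv_representation g gs \<longleftrightarrow>
     (\<forall>i. bounded_variation (gs i)) \<and> (\<forall>x. g x = (\<Sum>i\<in>UNIV. gs i (x $ i)))"

definition additive_bv :: "(real ^ 'n \<Rightarrow> real) set" where
  "additive_bv = {g. \<exists>gs. bv_representation g gs}"

definition additive_tv :: "(real ^ 'n \<Rightarrow> real) \<Rightarrow> real" where
  "additive_tv g = Inf {(\<Sum>i\<in>UNIV. total_variation (gs i)) | gs. bv_representation g gs}"

end

theory Submission
  imports Defs "HOL-Real_Asymp.Real_Asymp"
begin

text \<open>A cell whose label masses are \<open>p\<close> and \<open>q\<close> has risk
  \<open>min\<^sub>t (p ln (1 + e\<^sup>-\<^sup>t) + q ln (1 + e\<^sup>t))\<close>. Hence the risk is superadditive under
  splitting, and since it depends continuously on the threshold, a minimax split leaves at most half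
  of the risk in each child: a splittable cell at depth \<open>k\<close> has risk at most \<open>2\<^sup>-\<^sup>k ln 2\<close>.

  If \<open>g\<close> oscillates by \<open>\<delta>\<close> on a cell, then by convexity of the loss and
  \<open>h(\<eta>) \<ge> 4 ln 2 \<eta> (1 - \<eta>)\<close> the risk of the cell exceeds the loss of \<open>g\<close> there by at most
  \<open>\<delta> / (4 ln 2)\<close> times the risk, hence by at most \<open>2\<^sup>-\<^sup>k \<delta> / 4\<close>. The sum over the cells of the
  oscillation in coordinate \<open>j\<close> at most doubles in each step and does not grow when coordinate
  \<open>j\<close> is split, so the total excess is at most \<open>2\<^sup>-\<^sup>m TV(g) / 4\<close> with \<open>m = \<lfloor>k/d\<rfloor>\<close>.
  It is also at most \<open>ln 2\<close>, and the bound is the geometric mean of these two.\<close>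

section \<open>The entropy risk as a function of the label masses\<close>

text \<open>Binary entropy of \<open>p / (p + q)\<close> scaled by the total mass
  \<open>p + q\<close>. In terms of the masses no division occurs, so null cells need no separate
  treatment and continuity in the threshold is easy to state.\<close>

definition xent :: "real \<Rightarrow> real \<Rightarrow> real" where
  "xent p q = (p + q) * ln (p + q) - p * ln p - q * ln q"

lemma xent_zero [simp]: "xent 0 q = 0" "xent p 0 = 0"
  by (simp_all add: xent_def)

lemma xent_eq_entropy:
  assumes "0 \<le> p" "0 \<le> q"
  shows "xent p q = (p + q) * binary_entropy (p / (p + q))"
proof (cases "p = 0 \<or> q = 0")
  case True
  then show ?thesis by (auto simp: binary_entropy_def)
next
  case False
  with assms have "p > 0" "q > 0" by auto
  moreover from this have "1 - p / (p + q) = q / (p + q)" by (simp add: field_simps)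
  ultimately show ?thesis
    by (simp add: binary_entropy_def xent_def ln_div right_diff_distrib) (simp add: algebra_simps)
qed

text \<open>The log-odds \<open>ln (p / q)\<close> is the constant prediction at which the minimal
  logistic loss is attained.\<close>

lemma xent_log_odds:
  assumes "0 < p" "0 < q"
  shows "p * ln (1 + exp (- ln (p / q))) + q * ln (1 + exp (ln (p / q))) = xent p q"
proof -
  have "exp (- ln (p / q)) = q / p" using assms by (simp add: exp_minus)
  then have "1 + exp (- ln (p / q)) = (p + q) / p" "1 + exp (ln (p / q)) = (p + q) / q"
    using assms by (simp_all add: field_simps)
  then show ?thesis
    using assms by (simp add: ln_div xent_def) (simp add: algebra_simps)
qed

text \<open>The graph of the convex function \<open>ln (1 + exp x)\<close> lies above its tangent at
  \<open>m\<close>. After exponentiating, this is Jensen's inequality for \<open>exp\<close> between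
  \<open>0\<close> and \<open>x - m\<close>, with the slope \<open>s\<close> as weight.\<close>

lemma softplus_tangent:
  fixes x m :: real
  shows "ln (1 + exp m) + exp m / (1 + exp m) * (x - m) \<le> ln (1 + exp x)"
proof -
  define s where "s = exp m / (1 + exp m)"
  have pos: "1 + exp m > 0" "1 + exp x > 0" by (auto simp: add_pos_pos)
  have s: "0 \<le> s" "s \<le> 1" using pos by (auto simp: s_def divide_simps)
  have "exp (s * (x - m)) \<le> (1 - s) * exp 0 + s * exp (x - m)"
    using convex_onD[OF exp_convex s, of 0 "x - m"] by simp
  also have "\<dots> = (1 + exp x) / (1 + exp m)"
    using pos by (simp add: s_def exp_diff field_simps)
  finally have "exp (s * (x - m)) \<le> (1 + exp x) / (1 + exp m)" .
  then have "s * (x - m) \<le> ln ((1 + exp x) / (1 + exp m))"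
    using pos by (subst ln_ge_iff) auto
  then show ?thesis using pos by (simp add: ln_div s_def)
qed

text \<open>Both label terms are bounded below by their tangents at the log-odds \<open>m\<close>.
  The slopes \<open>q / (p + q)\<close> and \<open>p / (p + q)\<close>, weighted by \<open>p\<close>
  and \<open>q\<close>, have the common value \<open>p * q / (p + q)\<close>, so \<open>m\<close>
  cancels and only \<open>b - a\<close> remains.\<close>

lemma xent_le_loss_plus_gap:
  assumes "0 < p" "0 < q"
  shows "xent p q \<le> p * ln (1 + exp (- b)) + q * ln (1 + exp a) + p * q / (p + q) * (b - a)"
proof -
  define m where "m = ln (p / q)"
  have m: "exp m = p / q" "exp (- m) = q / p" using assms by (simp_all add: m_def exp_minus)
  have s: "exp m / (1 + exp m) = p / (p + q)" "exp (-m) / (1 + exp (-m)) = q / (p + q)"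
    unfolding m using assms by (simp_all add: field_simps)
  have 1: "p * (ln (1 + exp (-m)) + q / (p + q) * (- b + m)) \<le> p * ln (1 + exp (-b))"
    using softplus_tangent[of "-m" "-b"] assms s by (intro mult_left_mono) auto
  have 2: "q * (ln (1 + exp m) + p / (p + q) * (a - m)) \<le> q * ln (1 + exp a)"
    using softplus_tangent[of m a] assms s by (intro mult_left_mono) auto
  have "xent p q = p * ln (1 + exp (-m)) + q * ln (1 + exp m)"
    using xent_log_odds[OF assms] by (simp add: m_def)
  then show ?thesis using 1 2 by (simp add: algebra_simps add_divide_distrib diff_divide_distrib)
qed

lemma xent_le_loss:
  assumes "0 \<le> p" "0 \<le> q"
  shows "xent p q \<le> p * ln (1 + exp (- m)) + q * ln (1 + exp m)"
proof (cases "p = 0 \<or> q = 0")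
  case True
  have "0 \<le> p * ln (1 + exp (- m)) + q * ln (1 + exp m)" using assms by (simp add: add_nonneg_nonneg)
  with True show ?thesis by auto
next
  case False
  with xent_le_loss_plus_gap[of p q m m] assms show ?thesis by simp
qed

lemma xent_le_ln2: "0 \<le> p \<Longrightarrow> 0 \<le> q \<Longrightarrow> xent p q \<le> (p + q) * ln 2"
  using xent_le_loss[of p q 0] by (simp add: algebra_simps)

lemma xent_nonneg:
  assumes "0 \<le> p" "0 \<le> q" shows "0 \<le> xent p q"
proof (cases "p = 0 \<or> q = 0")
  case False
  with assms have "p > 0" "q > 0" by auto
  then show ?thesis unfolding xent_log_odds[symmetric, OF \<open>p > 0\<close> \<open>q > 0\<close>]
    by (intro add_nonneg_nonneg mult_nonneg_nonneg) auto
qed auto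

text \<open>Predicting the log-odds of the merged cell is optimal for the whole but in general
  suboptimal for each of the two pieces.\<close>

lemma xent_superadditive:
  assumes "0 \<le> p" "0 \<le> q" "0 \<le> p'" "0 \<le> q'"
  shows "xent p q + xent p' q' \<le> xent (p + p') (q + q')"
proof (cases "p + p' = 0 \<or> q + q' = 0")
  case True
  with assms have "(p = 0 \<and> p' = 0) \<or> (q = 0 \<and> q' = 0)" by linarith
  then show ?thesis by auto
next
  case False
  with assms have pos: "0 < p + p'" "0 < q + q'" by auto
  show ?thesis
    unfolding xent_log_odds[symmetric, OF pos]
    using xent_le_loss[OF assms(1,2), of "ln ((p + p') / (q + q'))"]
      xent_le_loss[OF assms(3,4), of "ln ((p + p') / (q + q'))"]
    by (simp add: algebra_simps)
qed

text \<open>Convexity of the power function on the nonnegative reals, at the midpoint of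
  \<open>u\<close> and \<open>1 - u\<close>.\<close>

lemma power_jensen_half:
  fixes u :: real
  assumes "0 \<le> u" "u \<le> 1"
  shows "2 * (1 / 2) ^ n \<le> u ^ n + (1 - u) ^ n"
proof -
  have "convex_on {0::real..} (\<lambda>x. x ^ n)"
    using convex_power_odd convex_on_subset[OF convex_power_even subset_UNIV] by (cases "even n") auto
  from convex_onD[OF this, of "1/2" u "1 - u"] assms
  show ?thesis by (simp add: field_simps)
qed

text \<open>The series of \<open>- ln (1 - u) / u\<close> has nonnegative coefficients, so its symmetrization in
  \<open>u\<close> and \<open>1 - u\<close> is minimal at \<open>1 / 2\<close>, term by term.\<close>

lemma four_ln2_le:
  fixes u :: real
  assumes "0 < u" "u < 1"
  shows "4 * ln 2 \<le> - ln (1 - u) / u - ln u / (1 - u)"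
proof -
  have S: "(\<lambda>n. v ^ n / real n / v) sums (- ln (1 - v) / v)" if "0 < v" "v < 1" for v :: real
  proof -
    have "(\<lambda>n. - ((- (- v)) ^ n) / of_nat n) sums ln (1 + (- v))"
      using that by (intro ln_series') auto
    from sums_divide[OF sums_minus[OF this], of v] show ?thesis by simp
  qed
  have 1: "(\<lambda>n. u ^ n / real n / u + (1 - u) ^ n / real n / (1 - u)) sums
      (- ln (1 - u) / u + - ln u / (1 - u))"
    using sums_add[OF S[of u] S[of "1 - u"]] assms by simp
  have 2: "(\<lambda>n. (1/2) ^ n / real n / (1/2) + (1/2) ^ n / real n / (1/2)) sums (4 * ln 2)"
    using sums_add[OF S[of "1/2"] S[of "1/2"]] by (simp add: ln_div)
  have "(1/2) ^ n / real n / (1/2) + (1/2) ^ n / real n / (1/2)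
      \<le> u ^ n / real n / u + (1 - u) ^ n / real n / (1 - u)" for n
  \<comment> \<open>The term for \<open>n = 0\<close> is zero because division by zero gives zero.
    For \<open>n = Suc k\<close> one power cancels against the division by \<open>u\<close>, so
    Jensen is applied with exponent \<open>k\<close>.\<close>
  proof (cases n)
    case (Suc k)
    have h: "(1 / 2 :: real) ^ n = (1 / 2) * (1 / 2) ^ k" by (simp add: Suc)
    have "(1/2) ^ n / real n / (1/2) + (1/2) ^ n / real n / (1/2) = (2 * (1/2) ^ k) / real n"
      using h by simp
    also have "\<dots> \<le> (u ^ k + (1 - u) ^ k) / real n"
      using power_jensen_half assms by (intro divide_right_mono) auto
    also have "\<dots> = u ^ n / real n / u + (1 - u) ^ n / real n / (1 - u)"
      using assms by (simp add: Suc add_divide_distrib)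
    finally show ?thesis .
  qed simp
  from sums_le[OF this 2 1] show ?thesis by simp
qed

text \<open>With \<open>u = p / (p + q)\<close> this is
  \<open>4 * ln 2 * u * (1 - u) \<le> h(u)\<close> times \<open>p + q\<close>, because
  \<open>h(u) / (u * (1 - u))\<close> is the function bounded in \<open>four_ln2_le\<close>.\<close>

lemma harmonic_le_xent:
  assumes "0 < p" "0 < q"
  shows "p * q / (p + q) \<le> xent p q / (4 * ln 2)"
proof -
  define u where "u = p / (p + q)"
  have u: "0 < u" "u < 1" "1 - u = q / (p + q)" using assms by (auto simp: u_def field_simps)
  have "- ln (1 - u) / u = (ln (p + q) - ln q) * ((p + q) / p)"
    "- ln u / (1 - u) = (ln (p + q) - ln p) * ((p + q) / q)"
    unfolding u(3) unfolding u_def using assms by (simp_all add: ln_div)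
  then have "p * q / (p + q) * (- ln (1 - u) / u - ln u / (1 - u)) =
      p * q / (p + q) * ((ln (p + q) - ln q) * ((p + q) / p) + (ln (p + q) - ln p) * ((p + q) / q))"
    by simp
  also have "\<dots> = q * (ln (p + q) - ln q) + p * (ln (p + q) - ln p)"
  proof -
    have "p * q / s * (c * (s / p)) = q * c" "p * q / s * (c * (s / q)) = p * c" if "s \<noteq> 0" for s c :: real
      using that assms by (simp_all add: field_simps)
    then show ?thesis using assms unfolding distrib_left by simp
  qed
  finally have "xent p q = p * q / (p + q) * (- ln (1 - u) / u - ln u / (1 - u))"
    by (simp add: xent_def algebra_simps)
  moreover have "p * q / (p + q) * (4 * ln 2) \<le> p * q / (p + q) * (- ln (1 - u) / u - ln u / (1 - u))"
    using four_ln2_le[OF u(1,2)] assms by (intro mult_left_mono) auto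
  ultimately have "p * q / (p + q) * (4 * ln 2) \<le> xent p q" by simp
  then show ?thesis by (subst pos_le_divide_eq) auto
qed

text \<open>The excess is expressed as a fraction of the risk itself, so that halving the risk along
  the tree also reduces the excess.\<close>

lemma xent_excess:
  assumes "0 \<le> p" "0 \<le> q" "a \<le> b"
  shows "xent p q \<le> p * ln (1 + exp (- b)) + q * ln (1 + exp a) + xent p q / (4 * ln 2) * (b - a)"
proof (cases "p = 0 \<or> q = 0")
  case True
  have "0 \<le> p * ln (1 + exp (- b)) + q * ln (1 + exp a)" using assms by (simp add: add_nonneg_nonneg)
  with True show ?thesis by auto
next
  case False
  with assms have pos: "0 < p" "0 < q" by auto
  have "p * q / (p + q) * (b - a) \<le> xent p q / (4 * ln 2) * (b - a)"
    using harmonic_le_xent[OF pos] assms by (intro mult_right_mono) auto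
  with xent_le_loss_plus_gap[OF pos, of b a] show ?thesis by linarith
qed

text \<open>The delicate point is \<open>0\<close>, where \<open>ln\<close> is discontinuous but
  \<open>x * ln x\<close> tends to \<open>0\<close>, in agreement with
  \<open>ln 0 = 0\<close>.\<close>

lemma continuous_on_x_ln_x: "continuous_on {0..} (\<lambda>x::real. x * ln x)"
  unfolding continuous_on_def
proof
  fix x :: real assume "x \<in> {0..}"
  show "((\<lambda>x. x * ln x) \<longlongrightarrow> x * ln x) (at x within {0..})"
  proof (cases "x = 0")
    case True
    have "((\<lambda>x::real. x * ln x) \<longlongrightarrow> 0) (at_right 0)" by real_asymp
    moreover have "at 0 within {0..} = at_right (0::real)"
      by (metis at_within_Ici_at_right)
    ultimately show ?thesis using True by simp
  next
    case False
    with \<open>x \<in> {0..}\<close> show ?thesis by (auto intro!: tendsto_intros)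
  qed
qed

lemma tendsto_xent:
  assumes "(f \<longlongrightarrow> p) F" "(g \<longlongrightarrow> q) F" "0 \<le> p" "0 \<le> q" "\<And>x. 0 \<le> f x" "\<And>x. 0 \<le> g x"
  shows "((\<lambda>x. xent (f x) (g x)) \<longlongrightarrow> xent p q) F"
proof -
  have *: "((\<lambda>x. h x * ln (h x)) \<longlongrightarrow> l * ln l) F" if "(h \<longlongrightarrow> l) F" "0 \<le> l" "\<And>x. 0 \<le> h x" for h and l :: real
    using continuous_on_tendsto_compose[OF continuous_on_x_ln_x that(1)] that by auto
  show ?thesis
    unfolding xent_def using assms by (intro tendsto_diff * tendsto_add) auto
qed

section \<open>Oscillation of functions of bounded variation\<close>

lemma total_variation_nonneg:
  assumes "bounded_variation f" shows "0 \<le> total_variation f"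
proof -
  have "0 \<in> variation_sums f"
    unfolding variation_sums_def by (intro CollectI exI[of _ "0::nat"] exI[of _ "\<lambda>_. 0"]) (auto simp: mono_def)
  then show ?thesis
    using assms unfolding total_variation_def bounded_variation_def by (rule cSup_upper)
qed

text \<open>The variation of \<open>f\<close> on the half-line up to \<open>x\<close>: a monotone
  function of \<open>x\<close> whose increments dominate those of \<open>f\<close>.\<close>

definition variation_upto :: "(real \<Rightarrow> real) \<Rightarrow> real \<Rightarrow> real" where
  "variation_upto f x =
     Sup {(\<Sum>i<n. \<bar>f (t (Suc i)) - f (t i)\<bar>) | n t. mono (t :: nat \<Rightarrow> real) \<and> (\<forall>i. t i \<le> x)}"

lemma
  assumes "bounded_variation f"
  shows variation_upto_upper: "mono (t :: nat \<Rightarrow> real) \<Longrightarrow> (\<And>i. t i \<le> x) \<Longrightarrow>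
      (\<Sum>i<n. \<bar>f (t (Suc i)) - f (t i)\<bar>) \<le> variation_upto f x"
    and variation_upto_nonneg: "0 \<le> variation_upto f x"
    and variation_upto_le: "variation_upto f x \<le> total_variation f"
proof -
  let ?S = "{(\<Sum>i<n. \<bar>f (t (Suc i)) - f (t i)\<bar>) | n t. mono (t :: nat \<Rightarrow> real) \<and> (\<forall>i. t i \<le> x)}"
  have sub: "?S \<subseteq> variation_sums f" unfolding variation_sums_def by auto
  then have bdd: "bdd_above ?S"
    using assms unfolding bounded_variation_def by (intro bdd_above_mono[OF _ sub])
  show le: "(\<Sum>i<n. \<bar>f (t (Suc i)) - f (t i)\<bar>) \<le> variation_upto f x"
    if "mono t" "\<And>i. t i \<le> x" for t :: "nat \<Rightarrow> real" and n
    unfolding variation_upto_def using that by (intro cSup_upper[OF _ bdd]) auto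
  show "0 \<le> variation_upto f x"
    using le[of "\<lambda>_. x" 0] by (simp add: mono_def)
  have ne: "?S \<noteq> {}" by (auto intro!: exI[of _ "\<lambda>_. x"] simp: mono_def)
  show "variation_upto f x \<le> total_variation f"
    unfolding variation_upto_def total_variation_def
    using assms unfolding bounded_variation_def by (intro cSup_subset_mono ne sub)
qed

text \<open>Any chain of points up to \<open>x\<close> can be prolonged by \<open>x\<close> and then
  \<open>y\<close>, which adds at least \<open>\<bar>f y - f x\<bar>\<close> to its
  variation.\<close>

lemma variation_upto_increment:
  assumes "bounded_variation f" "x \<le> y"
  shows "\<bar>f y - f x\<bar> \<le> variation_upto f y - variation_upto f x"
proof -
  let ?S = "{(\<Sum>i<n. \<bar>f (t (Suc i)) - f (t i)\<bar>) | n t. mono (t :: nat \<Rightarrow> real) \<and> (\<forall>i. t i \<le> x)}"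
  have ne: "?S \<noteq> {}" by (auto intro!: exI[of _ "\<lambda>_. x"] simp: mono_def)
  have "variation_upto f x \<le> variation_upto f y - \<bar>f y - f x\<bar>"
    unfolding variation_upto_def[of f x]
  proof (rule cSup_least[OF ne])
    fix v assume "v \<in> ?S"
    then obtain n t where v: "v = (\<Sum>i<n. \<bar>f (t (Suc i)) - f (t i)\<bar>)"
      and t: "mono (t :: nat \<Rightarrow> real)" "\<And>i. t i \<le> x" by auto
    \<comment> \<open>Chains are infinite monotone sequences, so the prolonged one stays at
      \<open>y\<close> from index \<open>n + 2\<close> on.\<close>
    define s where "s i = (if i \<le> n then t i else if i = Suc n then x else y)" for i
    have "mono s"
      using t \<open>x \<le> y\<close> order_trans[OF t(2) \<open>x \<le> y\<close>] by (auto simp: s_def mono_def)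
    moreover have "s i \<le> y" for i
      using \<open>x \<le> y\<close> order_trans[OF t(2) \<open>x \<le> y\<close>] by (auto simp: s_def)
    ultimately have "(\<Sum>i<Suc (Suc n). \<bar>f (s (Suc i)) - f (s i)\<bar>) \<le> variation_upto f y"
      by (rule variation_upto_upper[OF assms(1)])
    moreover have "(\<Sum>i<n. \<bar>f (s (Suc i)) - f (s i)\<bar>) = v"
      unfolding v by (intro sum.cong) (auto simp: s_def)
    ultimately have "v + \<bar>f x - f (t n)\<bar> + \<bar>f y - f x\<bar> \<le> variation_upto f y"
      by (simp add: s_def)
    then show "v \<le> variation_upto f y - \<bar>f y - f x\<bar>" by linarith
  qed
  then show ?thesis by linarith
qed

lemma mono_variation_upto: "bounded_variation f \<Longrightarrow> mono (variation_upto f)"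
  using variation_upto_increment by (fastforce intro!: monoI)

text \<open>Jordan decomposition: \<open>f\<close> is the difference of the monotone functions
  \<open>variation_upto f\<close> and \<open>variation_upto f - f\<close>.\<close>

lemma bounded_variation_borel_measurable:
  assumes "bounded_variation f" shows "f \<in> borel_measurable borel"
proof -
  have "mono (\<lambda>x. variation_upto f x - f x)"
    using variation_upto_increment[OF assms] by (fastforce intro!: monoI)
  from borel_measurable_diff[OF borel_measurable_mono[OF mono_variation_upto[OF assms]] borel_measurable_mono[OF this]]
  show ?thesis by simp
qed

lemma bounded_variation_diff_le:
  assumes "bounded_variation f" shows "\<bar>f x - f y\<bar> \<le> \<bar>variation_upto f x - variation_upto f y\<bar>"
  using variation_upto_increment[OF assms, of x y] variation_upto_increment[OF assms, of y x]
  by linarith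

text \<open>Only meaningful for nonempty \<open>A\<close>.\<close>

definition coord_osc :: "(real \<Rightarrow> real) \<Rightarrow> 'n \<Rightarrow> (real ^ 'n) set \<Rightarrow> real" where
  "coord_osc f j A = (SUP x\<in>A. variation_upto f (x $ j)) - (INF x\<in>A. variation_upto f (x $ j))"

lemma bdd_variation_upto:
  assumes "bounded_variation f"
  shows "bdd_above ((\<lambda>x. variation_upto f (x $ j)) ` A)" "bdd_below ((\<lambda>x. variation_upto f (x $ j)) ` A)"
  using variation_upto_nonneg[OF assms] variation_upto_le[OF assms]
  by (auto intro!: bdd_aboveI2 bdd_belowI2)

lemma coord_osc_upper:
  assumes "bounded_variation f" "x \<in> A" "y \<in> A"
  shows "\<bar>f (x $ j) - f (y $ j)\<bar> \<le> coord_osc f j A"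
proof -
  have *: "(INF x\<in>A. variation_upto f (x $ j)) \<le> variation_upto f (z $ j)"
    "variation_upto f (z $ j) \<le> (SUP x\<in>A. variation_upto f (x $ j))" if "z \<in> A" for z
    using that by (auto intro!: cINF_lower cSUP_upper bdd_variation_upto[OF assms(1)])
  show ?thesis
    using bounded_variation_diff_le[OF assms(1), of "x $ j" "y $ j"] *[OF assms(2)] *[OF assms(3)]
    unfolding coord_osc_def by linarith
qed

lemma coord_osc_nonneg: "bounded_variation f \<Longrightarrow> A \<noteq> {} \<Longrightarrow> 0 \<le> coord_osc f j A"
  using coord_osc_upper[of f _ A _ j] by fastforce

lemma coord_osc_mono:
  assumes "bounded_variation f" "A \<noteq> {}" "A \<subseteq> B"
  shows "coord_osc f j A \<le> coord_osc f j B"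
  unfolding coord_osc_def using assms
  by (intro diff_mono cSUP_subset_mono cINF_superset_mono bdd_variation_upto) auto

lemma coord_osc_le:
  assumes "bounded_variation f" "A \<noteq> {}"
  shows "coord_osc f j A \<le> total_variation f"
proof -
  have "(SUP x\<in>A. variation_upto f (x $ j)) \<le> total_variation f"
    using assms variation_upto_le by (intro cSUP_least)
  moreover have "0 \<le> (INF x\<in>A. variation_upto f (x $ j))"
    using assms variation_upto_nonneg by (intro cINF_greatest)
  ultimately show ?thesis unfolding coord_osc_def by linarith
qed

text \<open>By monotonicity of \<open>variation_upto f\<close>, its values left of the threshold lie
  below those on the right, so the two ranges do not overlap. For the oscillation of
  \<open>f\<close> itself the inequality can fail, which is why \<open>coord_osc\<close> measures
  the variation function instead.\<close>

lemma coord_osc_split: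
  assumes "bounded_variation f" "left_child j z A \<noteq> {}" "right_child j z A \<noteq> {}"
  shows "coord_osc f j (left_child j z A) + coord_osc f j (right_child j z A) \<le> coord_osc f j A"
proof -
  let ?T = "\<lambda>x. variation_upto f (x $ j)"
  have "(SUP x\<in>left_child j z A. ?T x) \<le> (INF x\<in>right_child j z A. ?T x)"
    using assms monoD[OF mono_variation_upto[OF assms(1)]]
    by (intro cSUP_least cINF_greatest) (auto simp: left_child_def right_child_def)
  moreover have "(INF x\<in>A. ?T x) \<le> (INF x\<in>left_child j z A. ?T x)"
    using assms by (intro cINF_superset_mono bdd_variation_upto) (auto simp: left_child_def)
  moreover have "(SUP x\<in>right_child j z A. ?T x) \<le> (SUP x\<in>A. ?T x)"
    using assms by (intro cSUP_subset_mono bdd_variation_upto) (auto simp: right_child_def)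
  ultimately show ?thesis unfolding coord_osc_def by linarith
qed

section \<open>Minimax splits\<close>

lemma children_measurable [measurable]:
  fixes A :: "(real ^ 'n) set"
  assumes [measurable]: "A \<in> sets borel"
  shows "left_child j z A \<in> sets borel" "right_child j z A \<in> sets borel"
proof -
  have "left_child j z A = A \<inter> {x. x $ j < z}" by (auto simp: left_child_def)
  moreover have "{x :: real ^ 'n. x $ j < z} \<in> sets borel"
    by (intro borel_open open_Collect_less continuous_intros)
  ultimately show "left_child j z A \<in> sets borel" by simp
  then show "right_child j z A \<in> sets borel" by (simp add: right_child_def)
qed

section \<open>Label masses and risks of cells\<close>

locale labelled_sample = prob_space M for M :: "'w measure" +
  fixes X :: "'w \<Rightarrow> real ^ 'n" and Y :: "'w \<Rightarrow> real"
  assumes X_measurable [measurable]: "X \<in> borel_measurable M"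
    and Y_measurable [measurable]: "Y \<in> borel_measurable M"
    and labels: "\<And>\<omega>. \<omega> \<in> space M \<Longrightarrow> Y \<omega> = -1 \<or> Y \<omega> = 1"
    and atomless: "marginally_atomless M X"
begin

definition mass :: "real \<Rightarrow> (real ^ 'n) set \<Rightarrow> real" where
  "mass y A = prob {\<omega> \<in> space M. X \<omega> \<in> A \<and> Y \<omega> = y}"

lemma mass_nonneg [simp]: "0 \<le> mass y A"
  by (simp add: mass_def)

lemma cell_weight_eq_mass:
  assumes [measurable]: "A \<in> sets borel"
  shows "cell_weight M X A = mass 1 A + mass (-1) A"
  unfolding cell_weight_def mass_def
  by (subst finite_measure_Union[symmetric]) (auto intro!: arg_cong[where f=prob] dest: labels)

lemma cell_eta_eq_mass:
  assumes "A \<in> sets borel"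
  shows "cell_eta M X Y A = mass 1 A / (mass 1 A + mass (-1) A)"
  unfolding cell_weight_eq_mass[OF assms, symmetric]
  by (simp add: cell_eta_def cond_prob_def mass_def cell_weight_def conj_commute)

lemma cell_risk_eq_xent:
  assumes "A \<in> sets borel"
  shows "cell_risk M X Y A = xent (mass 1 A) (mass (-1) A)"
  by (simp add: cell_risk_def cell_eta_eq_mass cell_weight_eq_mass assms xent_eq_entropy)

lemma cell_risk_nonneg: "A \<in> sets borel \<Longrightarrow> 0 \<le> cell_risk M X Y A"
  by (simp add: cell_risk_eq_xent xent_nonneg)

lemma mass_children:
  assumes [measurable]: "A \<in> sets borel"
  shows "mass y A = mass y (left_child j z A) + mass y (right_child j z A)"
  unfolding mass_def
  by (subst finite_measure_Union[symmetric])
    (auto intro!: arg_cong[where f=prob] simp: right_child_def left_child_def)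

lemma prob_coord_eq: "prob {\<omega> \<in> space M. X \<omega> $ j = x} = 0"
  using atomless by (simp add: marginally_atomless_def)

text \<open>As a function of the threshold, the mass of a left child is the distribution function of
  coordinate \<open>j\<close> on the event \<open>E\<close>; it is continuous because that
  coordinate has no atoms.\<close>

lemma mass_left_child_limits:
  assumes [measurable]: "A \<in> sets borel"
  shows "isCont (\<lambda>z. mass y (left_child j z A)) x"
    and "((\<lambda>z. mass y (left_child j z A)) \<longlongrightarrow> 0) at_bot"
    and "((\<lambda>z. mass y (left_child j z A)) \<longlongrightarrow> mass y A) at_top"
proof -
  define E where "E = {\<omega> \<in> space M. X \<omega> \<in> A \<and> Y \<omega> = y}"
  have E[measurable]: "E \<in> sets M" by (simp add: E_def)
  then have sub: "E \<subseteq> space M" by (rule sets.sets_into_space)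
  have Xj[measurable]: "(\<lambda>\<omega>. X \<omega> $ j) \<in> borel_measurable M"
    by (rule measurable_compose[OF X_measurable])
      (intro borel_measurable_continuous_onI continuous_intros)
  define N where "N = distr (restrict_space M E) borel (\<lambda>\<omega>. X \<omega> $ j)"
  have N: "measure N B = prob {\<omega> \<in> E. X \<omega> $ j \<in> B}" if [measurable]: "B \<in> sets borel" for B
  proof -
    have "measure N B = measure (restrict_space M E) ((\<lambda>\<omega>. X \<omega> $ j) -` B \<inter> space (restrict_space M E))"
      unfolding N_def by (rule measure_distr) (simp_all add: measurable_restrict_space1)
    also have "\<dots> = prob {\<omega> \<in> E. X \<omega> $ j \<in> B}"
      using sub by (subst measure_restrict_space) (auto simp: space_restrict_space intro!: arg_cong[where f=prob])
    finally show ?thesis .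
  qed
  interpret N: finite_borel_measure N
  proof -
    interpret R: finite_measure "restrict_space M E"
      by (rule finite_measure_restrict_space) (simp_all add: finite_measure_axioms)
    show "finite_borel_measure N"
      unfolding N_def
      by (intro finite_borel_measure.intro R.finite_measure_distr)
        (simp_all add: finite_borel_measure_axioms_def measurable_restrict_space1)
  qed
  have null: "prob {\<omega> \<in> E. X \<omega> $ j = z} = 0" for z
    using finite_measure_mono[of "{\<omega> \<in> E. X \<omega> $ j = z}" "{\<omega> \<in> space M. X \<omega> $ j = z}"] sub prob_coord_eq[of j z]
    by (auto simp: measure_le_0_iff)
  \<comment> \<open>A distribution function counts the points with
    \<open>X \<omega> $ j \<le> z\<close>, a left child those with strict inequality; the difference
    is a null set.\<close>
  have cdf: "mass y (left_child j z A) = cdf N z" for z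
  proof -
    have "cdf N z = prob ({\<omega> \<in> E. X \<omega> $ j < z} \<union> {\<omega> \<in> E. X \<omega> $ j = z})"
      unfolding cdf_def by (simp add: N) (auto intro!: arg_cong[where f=prob])
    also have "\<dots> = prob {\<omega> \<in> E. X \<omega> $ j < z}"
      by (subst finite_measure_Union) (auto simp: null)
    also have "\<dots> = mass y (left_child j z A)"
      unfolding mass_def E_def by (auto intro!: arg_cong[where f=prob] simp: left_child_def)
    finally show ?thesis by simp
  qed
  have "measure N {x} = 0" using N[of "{x}"] null[of x] by simp
  then show "isCont (\<lambda>z. mass y (left_child j z A)) x"
    unfolding cdf using N.isCont_cdf by (simp add: eta_contract_eq)
  show "((\<lambda>z. mass y (left_child j z A)) \<longlongrightarrow> 0) at_bot"
    unfolding cdf by (rule N.cdf_lim_at_bot)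
  have "measure N (space N) = mass y A"
    using N[of UNIV] by (simp add: N.borel_UNIV mass_def E_def)
  then show "((\<lambda>z. mass y (left_child j z A)) \<longlongrightarrow> mass y A) at_top"
    unfolding cdf using N.cdf_lim_at_top by simp
qed

lemma cell_risk_children_le:
  assumes "A \<in> sets borel"
  shows "cell_risk M X Y (left_child j z A) + cell_risk M X Y (right_child j z A) \<le> cell_risk M X Y A"
  using xent_superadditive[of "mass 1 (left_child j z A)" "mass (-1) (left_child j z A)"
      "mass 1 (right_child j z A)" "mass (-1) (right_child j z A)"] assms
  by (simp add: cell_risk_eq_xent children_measurable mass_children[of A _ j z])

text \<open>The risk of the left child moves continuously from \<open>0\<close> to the full risk, so
  some threshold gives it exactly half; superadditivity then leaves at most half for the right
  child.\<close>

lemma exists_halving_threshold: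
  assumes A: "A \<in> sets borel"
  shows "\<exists>z. split_objective M X Y j A z \<le> cell_risk M X Y A / 2"
proof -
  let ?F = "\<lambda>z. cell_risk M X Y (left_child j z A)"
  let ?r = "cell_risk M X Y A"
  have F: "?F = (\<lambda>z. xent (mass 1 (left_child j z A)) (mass (-1) (left_child j z A)))"
    using A by (simp add: cell_risk_eq_xent children_measurable)
  show ?thesis
  proof (cases "?r = 0")
    \<comment> \<open>With zero risk any threshold works. This case is separate because the search
      for \<open>a\<close> and \<open>b\<close> below uses strict inequalities around
      \<open>?r / 2\<close>.\<close>
    case True
    then show ?thesis
      using cell_risk_children_le[OF A, of j 0] cell_risk_nonneg[OF children_measurable(1)[OF A, of j 0]]
        cell_risk_nonneg[OF children_measurable(2)[OF A, of j 0]]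
      by (intro exI[of _ 0]) (simp add: split_objective_def)
  next
    case False
    then have r: "?r > 0" using cell_risk_nonneg[OF A] by simp
    note lim = mass_left_child_limits[OF A]
    have cont: "isCont ?F x" for x
      unfolding F isCont_def using lim(1)[unfolded isCont_def] by (intro tendsto_xent) auto
    have "(?F \<longlongrightarrow> xent 0 0) at_bot"
      unfolding F by (intro tendsto_xent lim) auto
    then have "eventually (\<lambda>z. ?F z < ?r / 2) at_bot"
      by (rule order_tendstoD) (use r in simp)
    \<comment> \<open>Separating the end points by \<open>0\<close> ensures \<open>a \<le> b\<close>
      for the intermediate value theorem.\<close>
    moreover have "eventually (\<lambda>z::real. z \<le> 0) at_bot" by (rule eventually_le_at_bot)
    ultimately have "eventually (\<lambda>z. ?F z < ?r / 2 \<and> z \<le> 0) at_bot" by (rule eventually_conj)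
    then obtain a where a: "?F a < ?r / 2" "a \<le> 0"
      using eventually_happens'[OF trivial_limit_at_bot_linorder] by blast
    have "(?F \<longlongrightarrow> ?r) at_top"
      unfolding F cell_risk_eq_xent[OF A] by (intro tendsto_xent lim) auto
    then have "eventually (\<lambda>z. ?F z > ?r / 2) at_top"
      by (rule order_tendstoD) (use r in simp)
    moreover have "eventually (\<lambda>z::real. 0 \<le> z) at_top" by (rule eventually_ge_at_top)
    ultimately have "eventually (\<lambda>z. ?F z > ?r / 2 \<and> 0 \<le> z) at_top" by (rule eventually_conj)
    then obtain b where b: "?F b > ?r / 2" "0 \<le> b"
      using eventually_happens'[OF trivial_limit_at_top_linorder] by blast
    obtain z where "?F z = ?r / 2"
      using IVT[of ?F a "?r / 2" b] a b cont by force
    then have "split_objective M X Y j A z \<le> ?r / 2"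
      using cell_risk_children_le[OF A, of j z] by (simp add: split_objective_def)
    then show ?thesis ..
  qed
qed

lemma minimax_children_le:
  assumes A: "A \<in> sets borel" and "minimax_threshold M X Y j A z"
  shows "cell_risk M X Y (left_child j z A) \<le> cell_risk M X Y A / 2"
    and "cell_risk M X Y (right_child j z A) \<le> cell_risk M X Y A / 2"
  using exists_halving_threshold[OF A, of j] assms(2)
  unfolding minimax_threshold_def split_objective_def by (meson max.bounded_iff order_trans)+

lemma measure_cond_law:
  assumes [measurable]: "A \<in> sets borel" "B \<in> sets borel" "Z \<in> borel_measurable M"
    and "cell_weight M X A > 0"
  shows "measure (cond_law M X A Z) B = prob {\<omega> \<in> space M. X \<omega> \<in> A \<and> Z \<omega> \<in> B} / cell_weight M X A"
proof -
  have "measure (cond_law M X A Z) B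
      = measure (uniform_measure M {\<omega> \<in> space M. X \<omega> \<in> A}) (Z -` B \<inter> space M)"
    unfolding cond_law_def by (subst measure_distr) auto
  also have "\<dots> = prob ({\<omega> \<in> space M. X \<omega> \<in> A} \<inter> (Z -` B \<inter> space M)) / cell_weight M X A"
    unfolding cell_weight_def using assms(4)
    by (subst measure_uniform_measure) (auto simp: emeasure_eq_measure cell_weight_def)
  also have "{\<omega> \<in> space M. X \<omega> \<in> A} \<inter> (Z -` B \<inter> space M) = {\<omega> \<in> space M. X \<omega> \<in> A \<and> Z \<omega> \<in> B}"
    by auto
  finally show ?thesis .
qed

text \<open>A degenerate label law makes one of the two label masses vanish. A degenerate law of
  \<open>X\<close> on a cell of positive weight contradicts atomlessness.\<close>

lemma unsplittable_cell_risk: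
  assumes A[measurable]: "A \<in> sets borel" and "unsplittable M X Y A"
  shows "cell_risk M X Y A = 0"
  using assms(2) unfolding unsplittable_def
proof (elim disjE conjE)
  assume w: "cell_weight M X A > 0" and "point_mass (cond_law M X A Y)"
  then obtain c where c: "cond_law M X A Y = return borel c" unfolding point_mass_def by auto
  have "mass y A / cell_weight M X A = indicator {y} c" for y
    using measure_cond_law[OF A _ Y_measurable w, of "{y}"] by (simp add: c measure_return mass_def)
  from this[of 1] this[of "-1"] w have "mass 1 A = 0 \<or> mass (-1) A = 0"
    by (cases "c = 1") (auto simp: indicator_def split: if_splits)
  then show ?thesis by (auto simp: cell_risk_eq_xent)
next
  assume w: "cell_weight M X A > 0" and "point_mass (cond_law M X A X)"
  then obtain c where c: "cond_law M X A X = return borel c" unfolding point_mass_def by auto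
  have "prob {\<omega> \<in> space M. X \<omega> \<in> A \<and> X \<omega> \<in> {c}} / cell_weight M X A = 1"
    using measure_cond_law[OF A _ X_measurable w, of "{c}"] by (simp add: c measure_return)
  \<comment> \<open>The event lies in a hyperplane orthogonal to a coordinate axis, which is null,
    whereas the preceding quotient equals \<open>1\<close>.\<close>
  moreover have "prob {\<omega> \<in> space M. X \<omega> \<in> A \<and> X \<omega> \<in> {c}} \<le> prob {\<omega> \<in> space M. X \<omega> $ j = c $ j}" for j
    by (intro finite_measure_mono) auto
  ultimately show ?thesis by (simp add: prob_coord_eq measure_le_0_iff)
qed (simp add: cell_risk_def)

section \<open>Borel partitions and integrals of cellwise functions\<close>

definition borel_partition :: "(real ^ 'n) set set \<Rightarrow> bool" where
  "borel_partition P \<longleftrightarrow> finite P \<and> disjoint P \<and> \<Union>P = UNIV \<and> P \<subseteq> sets borel"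

lemma borel_partition_step:
  assumes P: "borel_partition P" and step: "minimax_split_step M X Y j P P'"
  shows "borel_partition P'"
proof -
  let ?U = "unsplittable M X Y"
  from step obtain z where P': "P' = {A \<in> P. ?U A} \<union>
      (\<Union>A\<in>{A \<in> P. \<not> ?U A}. {left_child j (z A) A, right_child j (z A) A})"
    unfolding minimax_split_step_def by blast
  \<comment> \<open>Each old cell is replaced by a family with union \<open>A\<close>. Hence pieces
    of different old cells are disjoint, and only siblings have to be compared.\<close>
  define parts where "parts A = (if ?U A then {A} else {left_child j (z A) A, right_child j (z A) A})" for A
  have P'_eq: "P' = (\<Union>A\<in>P. parts A)" unfolding P' parts_def by (auto split: if_splits)
  have union: "\<Union>(parts A) = A" for A
    by (auto simp: parts_def left_child_def right_child_def)
  have disj: "B = C \<or> B \<inter> C = {}" if "B \<in> parts A" "C \<in> parts A" for A B C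
    using that by (auto simp: parts_def left_child_def right_child_def split: if_splits)
  have "disjoint P'"
  proof (rule disjointI)
    fix B C assume "B \<in> P'" "C \<in> P'" "B \<noteq> C"
    then obtain A A' where A: "A \<in> P" "A' \<in> P" "B \<in> parts A" "C \<in> parts A'" by (auto simp: P'_eq)
    show "B \<inter> C = {}"
    proof (cases "A = A'")
      case False
      then have "A \<inter> A' = {}" using P A unfolding borel_partition_def by (auto dest: disjointD)
      moreover have "B \<subseteq> A" "C \<subseteq> A'" using A(3,4) union[of A] union[of A'] by blast+
      ultimately show ?thesis by blast
    next
      case True
      then show ?thesis using disj[of B A C] A \<open>B \<noteq> C\<close> by simp
    qed
  qed
  moreover have "\<Union>P' = UNIV"
  proof -
    have "\<Union>P' = (\<Union>A\<in>P. \<Union>(parts A))" unfolding P'_eq by blast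
    then show ?thesis using P by (simp add: union borel_partition_def)
  qed
  moreover have "finite P'" using P by (auto simp: borel_partition_def P'_eq parts_def)
  moreover have "P' \<subseteq> sets borel"
    using P by (auto simp: borel_partition_def P'_eq parts_def children_measurable split: if_splits)
  ultimately show ?thesis by (simp add: borel_partition_def)
qed

lemma cell_of_eqI: "borel_partition P \<Longrightarrow> A \<in> P \<Longrightarrow> x \<in> A \<Longrightarrow> cell_of P x = A"
  unfolding cell_of_def borel_partition_def by (intro the_equality) (auto dest: disjointD)

lemma cell_of_mem:
  assumes "borel_partition P" shows "cell_of P x \<in> P" "x \<in> cell_of P x"
proof -
  obtain A where "A \<in> P" "x \<in> A" using assms unfolding borel_partition_def by blast
  then show "cell_of P x \<in> P" "x \<in> cell_of P x" using cell_of_eqI[OF assms] by auto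
qed

text \<open>Pointwise, only the summand of the cell containing \<open>X \<omega>\<close> and of the
  actual label survives. The lemma serves the log-odds loss, the constant \<open>ln 2\<close>, and a
  cellwise lower bound for the loss of \<open>g\<close>.\<close>

lemma has_integral_cellwise:
  assumes P: "borel_partition P"
  shows "has_bochner_integral M (\<lambda>\<omega>. c (Y \<omega>) (cell_of P (X \<omega>)))
    (\<Sum>A\<in>P. mass 1 A * c 1 A + mass (-1) A * c (-1) A)"
proof -
  let ?I = "\<lambda>y A. indicator {\<omega> \<in> space M. X \<omega> \<in> A \<and> Y \<omega> = y} :: 'w \<Rightarrow> real"
  have int: "has_bochner_integral M (?I y A) (mass y A)" if "A \<in> P" for A y
  proof -
    have [measurable]: "A \<in> sets borel" using that P by (auto simp: borel_partition_def)
    show ?thesis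
      unfolding mass_def by (intro has_bochner_integral_real_indicator) (auto simp: emeasure_eq_measure)
  qed
  have "has_bochner_integral M (\<lambda>\<omega>. \<Sum>A\<in>P. ?I 1 A \<omega> * c 1 A + ?I (-1) A \<omega> * c (-1) A)
      (\<Sum>A\<in>P. mass 1 A * c 1 A + mass (-1) A * c (-1) A)"
    by (intro has_bochner_integral_sum has_bochner_integral_add has_bochner_integral_mult_left int)
  moreover have "(\<Sum>A\<in>P. ?I 1 A \<omega> * c 1 A + ?I (-1) A \<omega> * c (-1) A) = c (Y \<omega>) (cell_of P (X \<omega>))"
    if \<omega>: "\<omega> \<in> space M" for \<omega>
  proof -
    note cell = cell_of_mem[OF P, of "X \<omega>"]
    have "(\<Sum>A\<in>P. ?I 1 A \<omega> * c 1 A + ?I (-1) A \<omega> * c (-1) A)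
        = (\<Sum>A\<in>P. if A = cell_of P (X \<omega>) then c (Y \<omega>) A else 0)"
    proof (intro sum.cong refl)
      fix A assume "A \<in> P"
      then have "X \<omega> \<in> A \<longleftrightarrow> A = cell_of P (X \<omega>)" using cell(2) cell_of_eqI[OF P] by metis
      then show "?I 1 A \<omega> * c 1 A + ?I (-1) A \<omega> * c (-1) A = (if A = cell_of P (X \<omega>) then c (Y \<omega>) A else 0)"
        using labels[OF \<omega>] \<omega> by (auto simp: indicator_def)
    qed
    also have "\<dots> = c (Y \<omega>) (cell_of P (X \<omega>))"
      using cell(1) P by (simp add: borel_partition_def)
    finally show ?thesis .
  qed
  ultimately show ?thesis by (subst has_bochner_integral_cong) auto
qed

section \<open>Sums over splittable cells under one split step\<close>

definition splittable_cells :: "(real ^ 'n) set set \<Rightarrow> (real ^ 'n) set set" where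
  "splittable_cells P = {A \<in> P. \<not> unsplittable M X Y A}"

lemma splittable_nonempty: "\<not> unsplittable M X Y A \<Longrightarrow> A \<noteq> {}"
  by (auto simp: unsplittable_def cell_weight_def)

lemma splittable_cells_stepE:
  assumes "minimax_split_step M X Y j P P'" "B \<in> splittable_cells P'"
  obtains A z where "A \<in> splittable_cells P" "minimax_threshold M X Y j A z"
    "B = left_child j z A \<or> B = right_child j z A"
  using assms unfolding minimax_split_step_def splittable_cells_def by auto

text \<open>Unsplittable children leave the sum, so \<open>g\<close> sets their contribution to
  zero; this also discards empty children, for which \<open>coord_osc\<close> has no
  meaning.\<close>

lemma sum_splittable_cells_step:
  fixes f :: "(real ^ 'n) set \<Rightarrow> real"
  defines "g \<equiv> \<lambda>B. if unsplittable M X Y B then 0 else f B"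
  assumes "finite P" and step: "minimax_split_step M X Y j P P'"
    and nonneg: "\<And>B. \<not> unsplittable M X Y B \<Longrightarrow> 0 \<le> f B"
    and children: "\<And>A z. \<not> unsplittable M X Y A \<Longrightarrow> g (left_child j z A) + g (right_child j z A) \<le> c * f A"
  shows "(\<Sum>B\<in>splittable_cells P'. f B) \<le> c * (\<Sum>A\<in>splittable_cells P. f A)"
proof -
  from step obtain z where P': "P' = {A \<in> P. unsplittable M X Y A} \<union>
      (\<Union>A\<in>{A \<in> P. \<not> unsplittable M X Y A}. {left_child j (z A) A, right_child j (z A) A})"
    unfolding minimax_split_step_def by blast
  let ?child = "\<lambda>(A, b). if b then left_child j (z A) A else right_child j (z A) A"
  have fin: "finite (splittable_cells P)" "finite (splittable_cells P')"
    using \<open>finite P\<close> by (auto simp: splittable_cells_def P')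
  have g0: "0 \<le> g B" for B using nonneg by (simp add: g_def)
  \<comment> \<open>Children are indexed by a parent and a boolean choosing the side. If two indices
    give the same set, it is counted twice on the right, which is harmless since \<open>g\<close> is
    nonnegative.\<close>
  have "(\<Sum>B\<in>splittable_cells P'. f B) \<le> (\<Sum>p\<in>splittable_cells P \<times> UNIV. g (?child p))"
  proof (rule sum_le_included[where i = ?child])
    show "\<forall>B\<in>splittable_cells P'. \<exists>p\<in>splittable_cells P \<times> UNIV. ?child p = B \<and> f B \<le> g (?child p)"
    proof
      fix B assume B: "B \<in> splittable_cells P'"
      then obtain A where A: "A \<in> splittable_cells P" "B = left_child j (z A) A \<or> B = right_child j (z A) A"
        by (auto simp: splittable_cells_def P')
      have "f B \<le> g B" using B by (simp add: splittable_cells_def g_def)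
      with A show "\<exists>p\<in>splittable_cells P \<times> UNIV. ?child p = B \<and> f B \<le> g (?child p)"
        by (intro bexI[of _ "(A, B = left_child j (z A) A)"]) auto
    qed
  qed (use fin g0 in auto)
  also have "\<dots> = (\<Sum>A\<in>splittable_cells P. g (left_child j (z A) A) + g (right_child j (z A) A))"
    unfolding sum.cartesian_product' by (simp add: UNIV_bool add.commute)
  also have "\<dots> \<le> (\<Sum>A\<in>splittable_cells P. c * f A)"
    using children by (intro sum_mono) (simp add: splittable_cells_def)
  finally show ?thesis by (simp add: sum_distrib_left)
qed

text \<open>A split in the coordinate itself divides the oscillation between the children; a split
  in another coordinate lets each of the two children inherit at most all of it.\<close>

lemma sum_coord_osc_step:
  assumes f: "bounded_variation f" and "finite P" "minimax_split_step M X Y j P P'"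
  shows "(\<Sum>B\<in>splittable_cells P'. coord_osc f i B) \<le>
    (if i = j then 1 else 2) * (\<Sum>A\<in>splittable_cells P. coord_osc f i A)"
proof (rule sum_splittable_cells_step[OF assms(2,3)])
  fix A z assume A: "\<not> unsplittable M X Y A"
  let ?L = "left_child j z A" and ?R = "right_child j z A"
  have sub: "?L \<subseteq> A" "?R \<subseteq> A" by (auto simp: left_child_def right_child_def)
  have mono: "coord_osc f i B \<le> coord_osc f i A" if "\<not> unsplittable M X Y B" "B \<subseteq> A" for B
    using coord_osc_mono[OF f splittable_nonempty[OF that(1)] that(2)] .
  show "(if unsplittable M X Y ?L then 0 else coord_osc f i ?L)
      + (if unsplittable M X Y ?R then 0 else coord_osc f i ?R) \<le> (if i = j then 1 else 2) * coord_osc f i A"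
    using mono[of ?L] mono[of ?R] sub coord_osc_nonneg[OF f splittable_nonempty[OF A], of i]
      coord_osc_split[OF f, of j z A] splittable_nonempty[of ?L] splittable_nonempty[of ?R]
    by (auto split: if_splits)
qed (rule coord_osc_nonneg[OF f splittable_nonempty])

end

section \<open>Decay of risk and oscillation along the tree\<close>

locale minimax_tree = labelled_sample M X Y
  for M :: "'w measure" and X :: "'w \<Rightarrow> real ^ 'n" and Y :: "'w \<Rightarrow> real" +
  fixes coord :: "nat \<Rightarrow> 'n" and \<pi> :: "nat \<Rightarrow> (real ^ 'n) set set"
  assumes coord: "bij_betw coord {1..CARD('n)} UNIV"
    and tree: "cyclic_minimax_split coord M X Y \<pi>"
begin

lemma step: "minimax_split_step M X Y (coord (1 + k mod CARD('n))) (\<pi> k) (\<pi> (Suc k))"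
  using tree by (simp add: cyclic_minimax_split_def)

lemma root: "\<pi> 0 = {UNIV}"
  using tree by (simp add: cyclic_minimax_split_def)

lemma partition: "borel_partition (\<pi> k)"
proof (induction k)
  case 0
  show ?case by (simp add: root borel_partition_def)
next
  case (Suc k)
  then show ?case using borel_partition_step step by blast
qed

lemma finite_cells: "finite (\<pi> k)" and cells_measurable: "A \<in> \<pi> k \<Longrightarrow> A \<in> sets borel"
  using partition[of k] by (auto simp: borel_partition_def)

text \<open>A splittable cell of depth \<open>k\<close> results from \<open>k\<close> successive
  minimax splits, each at least halving the risk, starting from at most \<open>ln 2\<close> at the
  root.\<close>

lemma splittable_cell_risk_le: "A \<in> splittable_cells (\<pi> k) \<Longrightarrow> cell_risk M X Y A \<le> ln 2 / 2 ^ k"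
proof (induction k arbitrary: A)
  case 0
  then have A: "A = UNIV" by (simp add: splittable_cells_def root)
  have "cell_risk M X Y A \<le> (mass 1 A + mass (-1) A) * ln 2"
    using A by (simp add: cell_risk_eq_xent xent_le_ln2)
  also have "\<dots> \<le> 1 * ln 2"
    using cell_weight_eq_mass[of A] A prob_space by (intro mult_right_mono) (auto simp: cell_weight_def)
  finally show ?case by simp
next
  case (Suc k)
  obtain B z where B: "B \<in> splittable_cells (\<pi> k)" "minimax_threshold M X Y (coord (1 + k mod CARD('n))) B z"
    "A = left_child (coord (1 + k mod CARD('n))) z B \<or> A = right_child (coord (1 + k mod CARD('n))) z B"
    by (rule splittable_cells_stepE[OF step Suc.prems])
  have "B \<in> sets borel" using B(1) cells_measurable by (auto simp: splittable_cells_def)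
  from minimax_children_le[OF this B(2)] B(3) have "cell_risk M X Y A \<le> cell_risk M X Y B / 2" by auto
  with Suc.IH[OF B(1)] show ?case by simp
qed

text \<open>There are at most \<open>2 ^ k\<close> splittable cells at depth \<open>k\<close>; the
  mean counts missing ones as zero. This normalization absorbs the possible doubling per step: the
  mean never grows, and it halves when coordinate \<open>j\<close> is split.\<close>

definition osc_mean :: "(real \<Rightarrow> real) \<Rightarrow> 'n \<Rightarrow> nat \<Rightarrow> real" where
  "osc_mean f j k = (\<Sum>A\<in>splittable_cells (\<pi> k). coord_osc f j A) / 2 ^ k"

lemma osc_mean_nonneg: "bounded_variation f \<Longrightarrow> 0 \<le> osc_mean f j k"
  unfolding osc_mean_def
  by (intro divide_nonneg_pos sum_nonneg coord_osc_nonneg)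
    (auto simp: splittable_cells_def dest: splittable_nonempty)

lemma osc_mean_Suc:
  assumes "bounded_variation f"
  shows "osc_mean f j (Suc k) \<le> osc_mean f j k"
    and "coord (1 + k mod CARD('n)) = j \<Longrightarrow> osc_mean f j (Suc k) \<le> osc_mean f j k / 2"
proof -
  have *: "osc_mean f j (Suc k) \<le> (if j = coord (1 + k mod CARD('n)) then 1 else 2) * osc_mean f j k / 2"
    using sum_coord_osc_step[OF assms finite_cells step, of j k]
    by (simp add: osc_mean_def divide_simps)
  then show "osc_mean f j (Suc k) \<le> osc_mean f j k"
    using osc_mean_nonneg[OF assms, of j k] by (auto split: if_splits)
  show "osc_mean f j (Suc k) \<le> osc_mean f j k / 2" if "coord (1 + k mod CARD('n)) = j"
    using * that by simp
qed

lemma osc_mean_antimono: "bounded_variation f \<Longrightarrow> k \<le> l \<Longrightarrow> osc_mean f j l \<le> osc_mean f j k"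
  by (rule lift_Suc_antimono_le[of "osc_mean f j"]) (auto intro: osc_mean_Suc)

text \<open>Every full cycle of \<open>CARD('n)\<close> steps splits coordinate \<open>j\<close>
  once and therefore halves the mean once.\<close>

lemma osc_mean_le:
  assumes f: "bounded_variation f"
  shows "osc_mean f j k \<le> total_variation f / 2 ^ (k div CARD('n))"
proof -
  \<comment> \<open>The offset of coordinate \<open>j\<close> within a cycle; \<open>coord\<close>
    is numbered from \<open>1\<close>, hence the shift.\<close>
  obtain r where r: "r < CARD('n)" "coord (1 + r) = j"
  proof -
    have "j \<in> coord ` {1..CARD('n)}" using coord by (simp add: bij_betw_def)
    then obtain m where "m \<in> {1..CARD('n)}" "j = coord m" by blast
    with that[of "m - 1"] show ?thesis by auto
  qed
  have "osc_mean f j (q * CARD('n)) \<le> total_variation f / 2 ^ q" for q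
  proof (induction q)
    case 0
    have "osc_mean f j 0 = (\<Sum>A\<in>splittable_cells {UNIV}. coord_osc f j A)"
      by (simp add: osc_mean_def root)
    \<comment> \<open>Only an inequality, since the root itself may be unsplittable.\<close>
    also have "\<dots> \<le> (\<Sum>A\<in>{UNIV}. coord_osc f j A)"
      using coord_osc_nonneg[OF f] by (intro sum_mono2) (auto simp: splittable_cells_def)
    also have "\<dots> \<le> total_variation f" using coord_osc_le[OF f, of UNIV j] by simp
    finally show ?case by simp
  next
    case (Suc q)
    let ?k = "q * CARD('n) + r"
    have "osc_mean f j (Suc q * CARD('n)) \<le> osc_mean f j (Suc ?k)"
      using r by (intro osc_mean_antimono f) simp
    also have "\<dots> \<le> osc_mean f j ?k / 2"
      using r by (intro osc_mean_Suc f) simp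
    also have "osc_mean f j ?k \<le> osc_mean f j (q * CARD('n))" by (intro osc_mean_antimono f) simp
    finally show ?case using Suc.IH by simp
  qed
  moreover have "osc_mean f j k \<le> osc_mean f j (k div CARD('n) * CARD('n))"
    by (intro osc_mean_antimono f) simp
  ultimately show ?thesis using order_trans by blast
qed

text \<open>On a cell with both labels the log-odds attains the entropy. On all other cells the loss
  is zero by convention, and so is the risk.\<close>

lemma log_loss_eq_risk:
  "(LINT \<omega>|M. logistic_loss (Y \<omega>) (log_odds_process M X Y \<pi> k \<omega>)) = (\<Sum>A\<in>\<pi> k. cell_risk M X Y A)"
proof -
  let ?c = "\<lambda>y A. logistic_loss y (log_odds (cell_eta M X Y A))"
  have "(LINT \<omega>|M. logistic_loss (Y \<omega>) (log_odds_process M X Y \<pi> k \<omega>))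
      = (\<Sum>A\<in>\<pi> k. mass 1 A * ?c 1 A + mass (-1) A * ?c (-1) A)"
    unfolding log_odds_process_def
    by (rule has_bochner_integral_integral_eq[OF has_integral_cellwise[OF partition, where c = ?c]])
  also have "\<dots> = (\<Sum>A\<in>\<pi> k. cell_risk M X Y A)"
  proof (intro sum.cong refl)
    fix A assume "A \<in> \<pi> k"
    then have A: "A \<in> sets borel" by (rule cells_measurable)
    let ?p = "mass 1 A" and ?q = "mass (-1) A"
    show "?p * ?c 1 A + ?q * ?c (-1) A = cell_risk M X Y A"
    proof (cases "?p = 0 \<or> ?q = 0")
      \<comment> \<open>This includes null cells, where division by zero makes
        \<open>cell_eta\<close> equal to \<open>0\<close>.\<close>
      case True
      then have "cell_eta M X Y A = 0 \<or> cell_eta M X Y A = 1"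
        by (auto simp: cell_eta_eq_mass[OF A])
      then have "?c y A = 0" for y by (auto simp: log_odds_def logistic_loss_def)
      with True show ?thesis by (auto simp: cell_risk_eq_xent[OF A])
    next
      case False
      then have pos: "0 < ?p" "0 < ?q" using mass_nonneg[of 1 A] mass_nonneg[of "-1" A] by linarith+
      let ?e = "cell_eta M X Y A"
      have "1 - ?e = ?q / (?p + ?q)" "?e = ?p / (?p + ?q)"
        using pos by (auto simp: cell_eta_eq_mass[OF A] field_simps)
      then have "?e / (1 - ?e) = ?p / ?q" "?e \<noteq> 0" "?e \<noteq> 1" using pos by auto
      then show ?thesis
        using xent_log_odds[OF pos] by (simp add: cell_risk_eq_xent[OF A] log_odds_def logistic_loss_def)
    qed
  qed
  finally show ?thesis .
qed

section \<open>Bounds on the total excess risk\<close>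

lemma sum_cell_risk_le_ln2: "(\<Sum>A\<in>\<pi> k. cell_risk M X Y A) \<le> ln 2"
proof -
  have "(\<Sum>A\<in>\<pi> k. cell_risk M X Y A) \<le> (\<Sum>A\<in>\<pi> k. mass 1 A * ln 2 + mass (-1) A * ln 2)"
    using xent_le_ln2 cells_measurable by (intro sum_mono) (simp add: cell_risk_eq_xent distrib_right)
  also have "\<dots> = ln 2"
    using has_bochner_integral_integral_eq[OF has_integral_cellwise[OF partition, where c = "\<lambda>_ _. ln 2"]]
    by (simp add: prob_space)
  finally show ?thesis .
qed

text \<open>The cellwise excess bounds are summed, and the oscillations are regrouped by coordinate
  so that \<open>osc_mean_le\<close> applies.\<close>

lemma excess_risk_le:
  assumes rep: "bv_representation g gs"
  shows "(\<Sum>A\<in>\<pi> k. cell_risk M X Y A) \<le>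
    (LINT \<omega>|M. ln (1 + exp (- (Y \<omega> * g (X \<omega>))))) + (\<Sum>i\<in>UNIV. total_variation (gs i)) / (4 * 2 ^ (k div CARD('n)))"
proof -
  have bv: "bounded_variation (gs i)" and g: "g x = (\<Sum>i\<in>UNIV. gs i (x $ i))" for i x
    using rep by (auto simp: bv_representation_def)
  define B where "B = (\<Sum>i\<in>UNIV. \<bar>gs i 0\<bar> + total_variation (gs i))"
  have g_bound: "\<bar>g x\<bar> \<le> B" for x
  proof -
    have "\<bar>gs i (x $ i)\<bar> \<le> \<bar>gs i 0\<bar> + total_variation (gs i)" for i
      using coord_osc_upper[OF bv[of i], of x UNIV 0 i] coord_osc_le[OF bv[of i], of UNIV i] by auto
    then show ?thesis unfolding g B_def by (intro order_trans[OF sum_abs sum_mono])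
  qed
  have bdd: "bdd_above (g ` A)" "bdd_below (g ` A)" for A
    using g_bound by (force intro!: bdd_aboveI2[of _ _ B] simp: abs_le_iff,
      metis abs_le_iff bdd_belowI2 g_bound minus_le_iff)
  have g_meas: "g \<in> borel_measurable borel"
    unfolding g
    by (intro borel_measurable_sum measurable_compose[OF _ bounded_variation_borel_measurable[OF bv]]
      borel_measurable_continuous_onI continuous_intros)
  \<comment> \<open>The most favourable value of \<open>g\<close> on the cell for each label: the
    supremum for label \<open>1\<close>, the infimum for label \<open>-1\<close>. This gives a
    cellwise lower bound for the loss of \<open>g\<close>.\<close>
  define loss where "loss y A = ln (1 + exp (if y = 1 then - (SUP x\<in>A. g x) else (INF x\<in>A. g x)))"
    for y :: real and A
  note int = has_integral_cellwise[OF partition[of k], where c = loss]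
  have "(\<Sum>A\<in>\<pi> k. mass 1 A * loss 1 A + mass (-1) A * loss (-1) A)
      = (LINT \<omega>|M. loss (Y \<omega>) (cell_of (\<pi> k) (X \<omega>)))"
    using has_bochner_integral_integral_eq[OF int] by simp
  also have "\<dots> \<le> (LINT \<omega>|M. ln (1 + exp (- (Y \<omega> * g (X \<omega>)))))"
  proof (rule integral_mono)
    show "integrable M (\<lambda>\<omega>. loss (Y \<omega>) (cell_of (\<pi> k) (X \<omega>)))"
      using int by (auto simp: has_bochner_integral_iff)
    show "integrable M (\<lambda>\<omega>. ln (1 + exp (- (Y \<omega> * g (X \<omega>)))))"
    proof (rule integrable_const_bound[where B = "ln (1 + exp B)"])
      show "AE \<omega> in M. norm (ln (1 + exp (- (Y \<omega> * g (X \<omega>))))) \<le> ln (1 + exp B)"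
      proof (rule AE_I2)
        fix \<omega> assume "\<omega> \<in> space M"
        then have "- (Y \<omega> * g (X \<omega>)) \<le> B"
          using labels[of \<omega>] g_bound[of "X \<omega>"] by auto
        then show "norm (ln (1 + exp (- (Y \<omega> * g (X \<omega>))))) \<le> ln (1 + exp B)"
          by (simp add: add_pos_pos)
      qed
      have [measurable]: "(\<lambda>\<omega>. g (X \<omega>)) \<in> borel_measurable M"
        by (rule measurable_compose[OF X_measurable g_meas])
      show "(\<lambda>\<omega>. ln (1 + exp (- (Y \<omega> * g (X \<omega>))))) \<in> borel_measurable M" by measurable
    qed
    fix \<omega> assume "\<omega> \<in> space M"
    moreover have "X \<omega> \<in> cell_of (\<pi> k) (X \<omega>)" by (rule cell_of_mem[OF partition])
    then have "g (X \<omega>) \<le> (SUP x\<in>cell_of (\<pi> k) (X \<omega>). g x)" "(INF x\<in>cell_of (\<pi> k) (X \<omega>). g x) \<le> g (X \<omega>)"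
      using bdd by (auto intro: cSUP_upper cINF_lower)
    ultimately show "loss (Y \<omega>) (cell_of (\<pi> k) (X \<omega>)) \<le> ln (1 + exp (- (Y \<omega> * g (X \<omega>))))"
      using labels[of \<omega>] by (auto simp: loss_def add_pos_pos)
  qed
  finally have loss_le: "(\<Sum>A\<in>\<pi> k. mass 1 A * loss 1 A + mass (-1) A * loss (-1) A)
      \<le> (LINT \<omega>|M. ln (1 + exp (- (Y \<omega> * g (X \<omega>)))))" .
  have cell: "cell_risk M X Y A \<le> mass 1 A * loss 1 A + mass (-1) A * loss (-1) A
      + (if unsplittable M X Y A then 0 else (\<Sum>i\<in>UNIV. coord_osc (gs i) i A) / (4 * 2 ^ k))"
    if A: "A \<in> \<pi> k" for A
  proof (cases "unsplittable M X Y A")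
    case True
    have "0 \<le> mass 1 A * loss 1 A + mass (-1) A * loss (-1) A"
      by (intro add_nonneg_nonneg mult_nonneg_nonneg) (auto simp: loss_def)
    with True unsplittable_cell_risk[OF cells_measurable[OF A]] show ?thesis by simp
  next
    case False
    then have ne: "A \<noteq> {}" by (rule splittable_nonempty)
    let ?b = "SUP x\<in>A. g x" and ?a = "INF x\<in>A. g x" and ?r = "cell_risk M X Y A"
    let ?osc = "\<Sum>i\<in>UNIV. coord_osc (gs i) i A"
    have osc: "g x \<le> g y + ?osc" if "x \<in> A" "y \<in> A" for x y
    proof -
      have "g x - g y = (\<Sum>i\<in>UNIV. gs i (x $ i) - gs i (y $ i))" by (simp add: g sum_subtractf)
      also have "\<dots> \<le> ?osc" using coord_osc_upper[OF bv that] by (intro sum_mono) (simp add: abs_le_iff)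
      finally show ?thesis by simp
    qed
    have "?b \<le> g y + ?osc" if "y \<in> A" for y using osc that by (intro cSUP_least ne)
    then have "?b - ?osc \<le> g y" if "y \<in> A" for y using that by (simp add: algebra_simps)
    then have "?b - ?osc \<le> ?a" by (intro cINF_greatest ne)
    then have diff: "?b - ?a \<le> ?osc" by simp
    have "?a \<le> ?b"
      using ne bdd by (meson all_not_in_conv cINF_lower cSUP_upper order_trans)
    then have "?r \<le> mass 1 A * loss 1 A + mass (-1) A * loss (-1) A + ?r / (4 * ln 2) * (?b - ?a)"
      using xent_excess[of "mass 1 A" "mass (-1) A" ?a ?b]
      by (simp add: cell_risk_eq_xent[OF cells_measurable[OF A]] loss_def)
    also have "?r / (4 * ln 2) * (?b - ?a) \<le> 1 / (4 * 2 ^ k) * ?osc"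
    proof (intro mult_mono diff)
      \<comment> \<open>The factor \<open>ln 2\<close> from the root risk cancels the one in the
        entropy inequality.\<close>
      show "?r / (4 * ln 2) \<le> 1 / (4 * 2 ^ k)"
        using splittable_cell_risk_le[of A k] A False by (simp add: splittable_cells_def field_simps)
    qed (use \<open>?a \<le> ?b\<close> in auto)
    finally show ?thesis using False by simp
  qed
  have "(\<Sum>A\<in>\<pi> k. cell_risk M X Y A) \<le> (\<Sum>A\<in>\<pi> k. mass 1 A * loss 1 A + mass (-1) A * loss (-1) A
      + (if unsplittable M X Y A then 0 else (\<Sum>i\<in>UNIV. coord_osc (gs i) i A) / (4 * 2 ^ k)))"
    by (rule sum_mono[OF cell])
  also have "\<dots> \<le> (LINT \<omega>|M. ln (1 + exp (- (Y \<omega> * g (X \<omega>)))))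
      + (\<Sum>A\<in>\<pi> k. if unsplittable M X Y A then 0 else (\<Sum>i\<in>UNIV. coord_osc (gs i) i A) / (4 * 2 ^ k))"
    using loss_le by (simp only: sum.distrib add_le_cancel_right)
  also have "(\<Sum>A\<in>\<pi> k. if unsplittable M X Y A then 0 else (\<Sum>i\<in>UNIV. coord_osc (gs i) i A) / (4 * 2 ^ k))
      = (\<Sum>A\<in>splittable_cells (\<pi> k). (\<Sum>i\<in>UNIV. coord_osc (gs i) i A) / (4 * 2 ^ k))"
    unfolding splittable_cells_def using finite_cells by (intro sum.mono_neutral_cong_right) auto
  \<comment> \<open>Exchanging the sums over cells and coordinates turns the factor
    \<open>1 / 2 ^ k\<close> into the normalization of \<open>osc_mean\<close>.\<close>
  also have "\<dots> = (\<Sum>i\<in>UNIV. osc_mean (gs i) i k) / 4"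
    unfolding osc_mean_def sum_divide_distrib by (subst sum.swap) (simp add: mult.commute)
  also have "\<dots> \<le> (\<Sum>i\<in>UNIV. total_variation (gs i) / 2 ^ (k div CARD('n))) / 4"
    using osc_mean_le[OF bv] by (intro divide_right_mono sum_mono) auto
  finally show ?thesis by (simp add: sum_divide_distrib mult.commute)
qed

lemma excess_risk_le_additive_tv:
  assumes "g \<in> additive_bv"
  shows "(\<Sum>A\<in>\<pi> k. cell_risk M X Y A) \<le>
    (LINT \<omega>|M. ln (1 + exp (- (Y \<omega> * g (X \<omega>))))) + additive_tv g / (4 * 2 ^ (k div CARD('n)))"
proof -
  let ?D = "(\<Sum>A\<in>\<pi> k. cell_risk M X Y A) - (LINT \<omega>|M. ln (1 + exp (- (Y \<omega> * g (X \<omega>)))))"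
  \<comment> \<open>Multiplied out, the bound says that the left side is a lower bound of the set
    whose infimum is \<open>additive_tv g\<close>.\<close>
  have "?D * (4 * 2 ^ (k div CARD('n))) \<le> additive_tv g"
    unfolding additive_tv_def
  proof (rule cInf_greatest)
    fix v assume "v \<in> {(\<Sum>i\<in>UNIV. total_variation (gs i)) | gs. bv_representation g gs}"
    then obtain gs where gs: "bv_representation g gs" "v = (\<Sum>i\<in>UNIV. total_variation (gs i))" by auto
    then have "?D \<le> v / (4 * 2 ^ (k div CARD('n)))" using excess_risk_le[OF gs(1), of k] by simp
    then show "?D * (4 * 2 ^ (k div CARD('n))) \<le> v" by (simp add: field_simps)
  qed (use assms in \<open>auto simp: additive_bv_def\<close>)
  then have "?D \<le> additive_tv g / (4 * 2 ^ (k div CARD('n)))" by (subst pos_le_divide_eq) auto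
  then show ?thesis by simp
qed

end

theorem theorem12:
  fixes M :: "'w measure"
    and X :: "'w \<Rightarrow> real ^ 'n"
    and Y :: "'w \<Rightarrow> real"
    and coord :: "nat \<Rightarrow> 'n"
    and \<pi> :: "nat \<Rightarrow> (real ^ 'n) set set"
    and k :: nat
  assumes "prob_space M"
    and "X \<in> borel_measurable M"
    and "Y \<in> borel_measurable M"
    and "\<forall>\<omega>\<in>space M. Y \<omega> \<in> {-1, 1}"
    and "marginally_atomless M X"
    and "bij_betw coord {1..CARD('n)} UNIV"
    and "cyclic_minimax_split coord M X Y \<pi>"
  shows "(LINT \<omega>|M. logistic_loss (Y \<omega>) (log_odds_process M X Y \<pi> k \<omega>))
    \<le> (INF g\<in>additive_bv.
         (LINT \<omega>|M. ln (1 + exp (- (Y \<omega> * g (X \<omega>)))))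
           + sqrt (ln 2 / 4) * 2 powr (- real (k div CARD('n)) / 2) * sqrt (additive_tv g))"
proof -
  interpret prob_space M by fact
  interpret minimax_tree M X Y coord \<pi>
    using assms by unfold_locales auto
  let ?R = "\<Sum>A\<in>\<pi> k. cell_risk M X Y A" and ?m = "k div CARD('n)"
  \<comment> \<open>The infimum is bounded below elementwise, which for reals requires a nonempty
    index set.\<close>
  have "(\<lambda>_. 0) \<in> additive_bv"
    unfolding additive_bv_def bv_representation_def bounded_variation_def variation_sums_def
    by (auto intro!: exI[of _ "\<lambda>_ _. 0"] bdd_aboveI[of _ 0])
  then have "additive_bv \<noteq> ({} :: (real ^ 'n \<Rightarrow> real) set)" by blast
  then show ?thesis
    unfolding log_loss_eq_risk
  proof (rule cINF_greatest)
    fix g :: "real ^ 'n \<Rightarrow> real" assume g: "g \<in> additive_bv"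
    let ?L = "LINT \<omega>|M. ln (1 + exp (- (Y \<omega> * g (X \<omega>))))" and ?V = "additive_tv g"
    have D: "?R - ?L \<le> ?V / (4 * 2 ^ ?m)" using excess_risk_le_additive_tv[OF g, of k] by simp
    \<comment> \<open>The loss of \<open>g\<close> is nonnegative, so the excess is at most the full
      risk, hence at most \<open>ln 2\<close>.\<close>
    have "0 \<le> ?L" by (intro Bochner_Integration.integral_nonneg) (simp add: add_pos_pos)
    then have D2: "?R - ?L \<le> ln 2" using sum_cell_risk_le_ln2[of k] by linarith
    have V: "0 \<le> ?V"
      unfolding additive_tv_def
    proof (rule cInf_greatest)
      show "{(\<Sum>i\<in>UNIV. total_variation (gs i)) | gs. bv_representation g gs} \<noteq> {}"
        using g by (auto simp: additive_bv_def)
    qed (auto simp: bv_representation_def intro!: sum_nonneg total_variation_nonneg)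
    have "?R - ?L \<le> sqrt (ln 2 * (?V / (4 * 2 ^ ?m)))"
    proof (cases "?R - ?L \<le> 0")
      case True
      have "0 \<le> sqrt (ln 2 * (?V / (4 * 2 ^ ?m)))" using V by simp
      with True show ?thesis by linarith
    next
      case False
      \<comment> \<open>One factor of the square is bounded by \<open>ln 2\<close>, the other by the
        variation bound; multiplying the bounds uses that the excess is positive in this
        case.\<close>
      then have "(?R - ?L)\<^sup>2 \<le> ln 2 * (?V / (4 * 2 ^ ?m))"
        unfolding power2_eq_square using D D2 by (intro mult_mono) auto
      then show ?thesis by (rule real_le_rsqrt)
    qed
    also have "\<dots> = sqrt (ln 2 / 4) * sqrt (1 / 2 ^ ?m) * sqrt ?V"
      by (simp add: real_sqrt_mult[symmetric])
    also have "sqrt (1 / 2 ^ ?m) = 2 powr (- real ?m / 2)"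
    proof -
      have "1 / 2 ^ ?m = (2 :: real) powr (- real ?m)"
        by (simp add: powr_minus powr_realpow field_simps)
      then show ?thesis by (simp add: powr_half_sqrt[symmetric] powr_powr)
    qed
    finally show "?R \<le> ?L + sqrt (ln 2 / 4) * 2 powr (- real ?m / 2) * sqrt ?V" by simp
  qed
qed

end
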